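(* Let $q=2^m$ for some integer $m\ge2$. Then there exists a distance-biregular graph with intersection array \[ \begin{vmatrix} q+2; & 1, & 2, & \frac{(q+1)q}{4}, & q+2 \\ \frac{q(q-1)}{2}; & 1, & \frac q2, & q+1, & \frac{q(q-1)}{2}\end{vmatrix}. \]
   Context: A bipartite graph with bipartition $Y\cup Z$ is distance-biregular if for every vertex $a$, every $i$, and every vertex $w$ at distance $i$ from $a$, the numbers $c_i(a)=|\{u\sim w: d(a,u)=i-1\}|$ and $b_i(a)=|\{u\sim w: d(a,u)=i+1\}|$ depend only on $i$ and on which part contains $a$. The intersection array $\begin{vmatrix} k; & c_1^{Y}, & \dots, & c_{d_Y}^{Y} \\ \ell; & c_1^{Z}, & \dots, & c_{d_Z}^{Z}\end{vmatrix}$ records the valency $k$ of vertices in $Y$, the valency $\ell$ of vertices in $Z$, and the numbers $c_i$ (for vertices in $Y$, resp. $Z$) for $1\le i\le d_Y$ (resp. $d_Z$), the eccentricities of vertices in $Y$ (resp. $Z$). *)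

theory Defs
  imports "Graph_Theory.Graph_Theory"
begin

text \<open>
  Finite simple graphs are the \<^locale>\<open>pair_graph\<close>s: finite loop-free symmetric digraphs
  without parallel arcs, each edge being a pair of opposite arcs.
\<close>

text \<open>
  The value is only meaningful when \<open>v\<close> is reachable from \<open>u\<close>;
  it is used below for connected graphs only.
\<close>
definition gdist :: "'a pair_pre_digraph \<Rightarrow> 'a \<Rightarrow> 'a \<Rightarrow> nat" where
  "gdist G u v = (LEAST n. \<exists>p. pre_digraph.awalk (with_proj G) u p v \<and> length p = n)"

lemma (in pair_wf_digraph) gdist_eq_mu:
  assumes "u \<rightarrow>\<^sup>*\<^bsub>with_proj G\<^esub> v"
  shows "ereal (real (gdist G u v)) = \<mu> (\<lambda>_. 1) u v"
proof -
  have cost: "awalk_cost (\<lambda>_. 1) p = real (length p)" for p :: "('a \<times> 'a) list"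
    by (induction p) auto
  from assms obtain p0 where "awalk u p0 v"
    by (auto simp: reachable_awalk)
  then have "\<exists>n p. awalk u p v \<and> length p = n" by blast
  from LeastI_ex[OF this] obtain p where p: "awalk u p v" "length p = gdist G u v"
    unfolding gdist_def by blast
  have le: "gdist G u v \<le> length p'" if "awalk u p' v" for p'
    unfolding gdist_def using that by (intro Least_le) blast
  show ?thesis
    unfolding \<mu>_def cost
  proof (rule INF_eqI[symmetric])
    show "ereal (real (gdist G u v)) \<le> ereal (real (length i))"
      if "i \<in> {p. awalk u p v}" for i
      using le that by simp
    show "y \<le> ereal (real (gdist G u v))"
      if "\<And>i. i \<in> {p. awalk u p v} \<Longrightarrow> y \<le> ereal (real (length i))" for y
      using that[of p] p by simp
  qed
qed

definition eccentricity :: "'a pair_pre_digraph \<Rightarrow> 'a \<Rightarrow> nat" where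
  "eccentricity G a = Max (gdist G a ` pverts G)"

text \<open>
  For \<open>w\<close> at distance \<open>i\<close> from \<open>a\<close>, the next two are the numbers
  \<open>c\<^sub>i(a)\<close> and \<open>b\<^sub>i(a)\<close> computed at \<open>w\<close>. Writing
  \<open>d(a,u) + 1 = i\<close> avoids truncated subtraction, so that \<open>c\<^sub>0(a) = 0\<close>.
\<close>
definition c_number :: "'a pair_pre_digraph \<Rightarrow> 'a \<Rightarrow> 'a \<Rightarrow> nat" where
  "c_number G a w = card {u. (w, u) \<in> parcs G \<and> gdist G a u + 1 = gdist G a w}"

definition b_number :: "'a pair_pre_digraph \<Rightarrow> 'a \<Rightarrow> 'a \<Rightarrow> nat" where
  "b_number G a w = card {u. (w, u) \<in> parcs G \<and> gdist G a u = gdist G a w + 1}"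

definition bipartition :: "'a pair_pre_digraph \<Rightarrow> 'a set \<Rightarrow> 'a set \<Rightarrow> bool" where
  "bipartition G Y Z \<longleftrightarrow>
     Y \<noteq> {} \<and> Z \<noteq> {} \<and> Y \<inter> Z = {} \<and> Y \<union> Z = pverts G \<and>
     (\<forall>(u, v) \<in> parcs G. u \<in> Y \<and> v \<in> Z \<or> u \<in> Z \<and> v \<in> Y)"

definition distance_biregular :: "'a pair_pre_digraph \<Rightarrow> 'a set \<Rightarrow> 'a set \<Rightarrow> bool" where
  "distance_biregular G Y Z \<longleftrightarrow>
     pair_graph G \<and> Digraph_Component.connected (with_proj G) \<and> bipartition G Y Z \<and>
     (\<forall>P \<in> {Y, Z}. \<forall>a \<in> P. \<forall>a' \<in> P. \<forall>w \<in> pverts G. \<forall>w' \<in> pverts G.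
        gdist G a w = gdist G a' w' \<longrightarrow>
          c_number G a w = c_number G a' w' \<and> b_number G a w = b_number G a' w')"

text \<open>
  One row \<open>k; c\<^sub>1, \<dots>, c\<^sub>d\<close> of the intersection array, belonging to the part \<open>P\<close>.
  The list is indexed from \<open>0\<close>, so \<open>c\<^sub>i\<close> is its entry number \<open>i - 1\<close>.
\<close>
definition array_row :: "'a pair_pre_digraph \<Rightarrow> 'a set \<Rightarrow> nat \<Rightarrow> nat list \<Rightarrow> bool" where
  "array_row G P k cs \<longleftrightarrow>
     (\<forall>a \<in> P. out_degree (with_proj G) a = k \<and> eccentricity G a = length cs \<and>
        (\<forall>i \<in> {1..length cs}. \<forall>w \<in> pverts G.
           gdist G a w = i \<longrightarrow> c_number G a w = cs ! (i - 1)))"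

definition has_intersection_array ::
  "'a pair_pre_digraph \<Rightarrow> 'a set \<Rightarrow> 'a set \<Rightarrow> nat \<times> nat list \<Rightarrow> nat \<times> nat list \<Rightarrow> bool" where
  "has_intersection_array G Y Z rY rZ \<longleftrightarrow>
     array_row G Y (fst rY) (snd rY) \<and> array_row G Z (fst rZ) (snd rZ)"

end

theory Submission
  imports Defs "HOL-Algebra.Algebraic_Closure_Type" "HOL-Library.Z2"
begin

text \<open>
  Let \<open>O\<close> be a hyperoval of \<open>PG(2,q)\<close>, a set of \<open>q + 2\<close> points meeting every line in \<open>0\<close> or \<open>2\<close>
  points; for even \<open>q\<close> a conic together with its nucleus is one. Fix a vector for each point of \<open>O\<close>.
  Let \<open>Y\<close> be the set of linear functionals vanishing nowhere on \<open>O\<close> (the multiples of the external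
  lines), let \<open>Z = O \<times> F\<^sub>q\<^sup>*\<close>, and join \<open>f\<close> to \<open>(p, f p)\<close> for every \<open>p \<in> O\<close>.
  Distinct \<open>f, g \<in> Y\<close> agree exactly where \<open>f - g\<close> vanishes on \<open>O\<close>, hence have \<open>0\<close> or \<open>2\<close> common
  neighbours. The functionals with prescribed nonzero values at two points of \<open>O\<close> form a family of
  size \<open>q\<close>; each of the other \<open>q\<close> points is a zero of exactly one of them, and zeros come in pairs, so
  \<open>q/2\<close> of them lie in \<open>Y\<close>. The intersection array follows from these two facts by double counting.
\<close>

section \<open>Distances via a potential\<close>

text \<open>Slow growth along arcs makes \<open>d w\<close> a lower bound for the length of every
  walk from \<open>a\<close> to \<open>w\<close>; descending through predecessors gives a walk of
  exactly that length. Distances can thus be verified from a guessed formula, and reachability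
  follows as well.\<close>

lemma (in pair_wf_digraph) gdist_eqI:
  assumes a: "a \<in> pverts G" "d a = 0"
    and step: "\<And>u v. (u, v) \<in> parcs G \<Longrightarrow> d v \<le> d u + 1"
    and pred: "\<And>v. v \<in> pverts G \<Longrightarrow> v \<noteq> a \<Longrightarrow> \<exists>u. (u, v) \<in> parcs G \<and> d v = d u + 1"
    and w: "w \<in> pverts G"
  shows "gdist G a w = d w" and "a \<rightarrow>\<^sup>*\<^bsub>with_proj G\<^esub> w"
proof -
  have lower: "d v \<le> d u + length p" if "awalk u p v" for u p v
    using that
  proof (induction p arbitrary: u)
    case Nil
    then show ?case by (auto simp: awalk_Nil_iff)
  next
    case (Cons e p)
    then have "(u, snd e) \<in> parcs G" "awalk (snd e) p v"
      by (auto simp: awalk_Cons_iff)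
    with Cons.IH step[of u "snd e"] show ?case by fastforce
  qed
  have upper: "\<exists>p. awalk a p v \<and> length p = d v" if "v \<in> pverts G" for v
    using that
  proof (induction "d v" arbitrary: v)
    case 0
    then have "v = a" using pred[of v] by fastforce
    with 0 show ?case by (auto simp: awalk_Nil_iff)
  next
    case (Suc n)
    then have "v \<noteq> a" using a by auto
    with pred Suc.prems obtain u where u: "(u, v) \<in> parcs G" "d v = d u + 1" by blast
    then have "u \<in> pverts G" using arc_fst_in_verts by fastforce
    with Suc.hyps u obtain p where p: "awalk a p u" "length p = d u" by force
    have "awalk u [(u, v)] v" using u arc_implies_awalk[of "(u, v)"] by simp
    with p have "awalk a (p @ [(u, v)]) v" by (auto simp del: awalk_append_iff intro: awalk_appendI)
    with p u show ?case by (intro exI[of _ "p @ [(u, v)]"]) simp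
  qed
  from upper[OF w] obtain p where p: "awalk a p w" "length p = d w" by blast
  show "gdist G a w = d w"
    unfolding gdist_def
  proof (rule Least_equality)
    show "\<exists>p. awalk a p w \<and> length p = d w" using p by blast
    show "d w \<le> n" if "\<exists>p. awalk a p w \<and> length p = n" for n
      using that lower a by fastforce
  qed
  show "a \<rightarrow>\<^sup>*\<^bsub>with_proj G\<^esub> w"
    using p reachable_awalkI by blast
qed

section \<open>Transversal designs in which two blocks meet in 0 or 2 points\<close>

text \<open>Blocks are the elements of \<open>Y\<close>, points those of \<open>Z\<close>; \<open>grp\<close> assigns to a point its group.\<close>

locale transversal_design =
  fixes Y Z :: "'v set" and I :: "'v \<Rightarrow> 'v \<Rightarrow> bool" and grp :: "'v \<Rightarrow> 'g" and q :: nat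
  assumes finite_Y: "finite Y" and finite_Z: "finite Z" and disjoint: "Y \<inter> Z = {}"
    and Z_nonempty: "Z \<noteq> {}" and q_ge: "q \<ge> 4" and q_even: "even q"
    and transversal: "y \<in> Y \<Longrightarrow> z \<in> Z \<Longrightarrow> \<exists>!z'. z' \<in> Z \<and> I y z' \<and> grp z' = grp z"
    and card_block: "y \<in> Y \<Longrightarrow> card {z \<in> Z. I y z} = q + 2"
    and card_point: "z \<in> Z \<Longrightarrow> card {y \<in> Y. I y z} = q * (q - 1) div 2"
    and meet: "y \<in> Y \<Longrightarrow> y' \<in> Y \<Longrightarrow> y \<noteq> y' \<Longrightarrow> card {z \<in> Z. I y z \<and> I y' z} \<in> {0, 2}"
    and join: "z \<in> Z \<Longrightarrow> z' \<in> Z \<Longrightarrow> grp z \<noteq> grp z' \<Longrightarrow> card {y \<in> Y. I y z \<and> I y z'} = q div 2"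
    and group_nontrivial: "z \<in> Z \<Longrightarrow> \<exists>z'\<in>Z. z' \<noteq> z \<and> grp z' = grp z"
begin

section \<open>The incidence graph and a formula for its distances\<close>

definition G :: "'v pair_pre_digraph" where
  "G = \<lparr>pverts = Y \<union> Z,
        parcs = {(u, v). u \<in> Y \<and> v \<in> Z \<and> I u v \<or> u \<in> Z \<and> v \<in> Y \<and> I v u}\<rparr>"

definition nb :: "'v \<Rightarrow> 'v set" where
  "nb w = {u. (w, u) \<in> parcs G}"

definition meets :: "'v \<Rightarrow> 'v \<Rightarrow> bool" where
  "meets y y' \<longleftrightarrow> (\<exists>z\<in>Z. I y z \<and> I y' z)"

text \<open>The guess for the distance in \<open>G\<close>, confirmed in \<open>gdist_G\<close>. It
  is meaningful only on \<open>Y \<union> Z\<close>: a first argument outside \<open>Y\<close> is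
  treated as a point.\<close>

definition \<delta> :: "'v \<Rightarrow> 'v \<Rightarrow> nat" where
  "\<delta> a w =
     (if a = w then 0
      else if a \<in> Y then
        (if w \<in> Y then if meets a w then 2 else 4 else if I a w then 1 else 3)
      else
        (if w \<in> Z then if grp a = grp w then 4 else 2 else if I w a then 1 else 3))"

lemma pverts_G: "pverts G = Y \<union> Z"
  by (simp add: G_def)

lemma nb_Y: "y \<in> Y \<Longrightarrow> nb y = {z \<in> Z. I y z}"
  using disjoint by (auto simp: nb_def G_def)

lemma nb_Z: "z \<in> Z \<Longrightarrow> nb z = {y \<in> Y. I y z}"
  using disjoint by (auto simp: nb_def G_def)

lemma finite_nb: "w \<in> Y \<union> Z \<Longrightarrow> finite (nb w)"
  using finite_Y finite_Z by (auto simp: nb_Y nb_Z)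

lemma not_both: "w \<in> Y \<Longrightarrow> w \<in> Z \<Longrightarrow> False"
  using disjoint by blast

lemma same_group_unique:
  assumes "y \<in> Y" "z \<in> Z" "z' \<in> Z" "I y z" "I y z'" "grp z = grp z'"
  shows "z = z'"
  by (rule ex1E[OF transversal[OF assms(1,2)]]) (use assms in metis)

section \<open>Counting the neighbours that are one step nearer\<close>

lemma degree_pos: "q * (q - 1) div 2 > 0"
proof -
  have "4 * 3 \<le> q * (q - 1)" using q_ge by (intro mult_mono) auto
  then show ?thesis by simp
qed

text \<open>Double counting of the pairs of a block \<open>y'\<close> through \<open>z\<close> and a
  point \<open>z'\<close> common to \<open>y\<close> and \<open>y'\<close>. By \<open>meet\<close>,
  each \<open>y'\<close> meeting \<open>y\<close> contributes two; by \<open>join\<close>, each of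
  the \<open>q + 1\<close> points of \<open>y\<close> outside the group of \<open>z\<close>
  contributes \<open>q div 2\<close>.\<close>

lemma card_meeting_through:
  assumes y: "y \<in> Y" and z: "z \<in> Z" and nI: "\<not> I y z"
  shows "card {y' \<in> Y. I y' z \<and> meets y y'} = (q + 1) * q div 4"
proof -
  let ?S = "{y' \<in> Y. I y' z}"
  obtain z0 where z0: "z0 \<in> Z" "I y z0" "grp z0 = grp z"
    using transversal[OF y z] by blast
  have common: "card {z' \<in> Z. I y z' \<and> I y' z'} = (if meets y y' then 2 else 0)" if "y' \<in> ?S" for y'
  proof -
    have "y \<noteq> y'" using that nI by auto
    moreover have "card {z' \<in> Z. I y z' \<and> I y' z'} = 0 \<longleftrightarrow> \<not> meets y y'"
      using finite_Z by (auto simp: meets_def)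
    ultimately show ?thesis using meet[of y y'] y that by auto
  qed
  have "2 * card {y' \<in> Y. I y' z \<and> meets y y'} = (\<Sum>y'\<in>?S. card {z' \<in> {z' \<in> Z. I y z'}. I y' z'})"
    using finite_Y common by (simp add: sum.If_cases Int_def conj_assoc)
  also have "\<dots> = (\<Sum>z'\<in>{z' \<in> Z. I y z'}. if z' = z0 then 0 else q div 2)"
  proof (rule sum_multicount_gen)
    \<comment> \<open>No block through \<open>z\<close> contains \<open>z0\<close>: they are
      distinct points of one group, since only \<open>z0\<close> lies on \<open>y\<close>.\<close>
    have "card {y' \<in> ?S. I y' z0} = 0"
      using same_group_unique[of _ z z0] z z0 nI by (auto simp: card_eq_0_iff)
    moreover have "card {y' \<in> ?S. I y' z'} = q div 2" if "z' \<in> Z" "I y z'" "z' \<noteq> z0" for z'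
      using join[of z z'] same_group_unique[of y z0 z'] that z z0 y by (auto simp: conj_assoc)
    ultimately show "\<forall>z'\<in>{z' \<in> Z. I y z'}. card {y' \<in> ?S. I y' z'} = (if z' = z0 then 0 else q div 2)"
      by simp
  qed (use finite_Y finite_Z in auto)
  also have "\<dots> = card ({z' \<in> Z. I y z'} - {z0}) * (q div 2)"
    using finite_Z by (simp add: sum.If_cases Diff_eq)
  also have "\<dots> = (q + 1) * (q div 2)"
    using card_block[OF y] z0 finite_Z by simp
  \<comment> \<open>Doubling turns \<open>q div 2\<close> back into \<open>q\<close>, as
    \<open>q\<close> is even; hence the division by 4 in the claim is exact.\<close>
  finally have "4 * card {y' \<in> Y. I y' z \<and> meets y y'} = (q + 1) * q"
    using q_even by auto
  then show ?thesis by simp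
qed

text \<open>Positivity supplies predecessors at distance 3. The strict inequality, which comes from
  q > 3, supplies a block through a point \<open>z\<close> that is disjoint from a given block not
  containing \<open>z\<close>.\<close>

lemma c_pos: "(q + 1) * q div 4 > 0" and c_less_degree: "(q + 1) * q div 4 < q * (q - 1) div 2"
proof -
  have "1 * 4 \<le> (q + 1) * q" using q_ge by (intro mult_mono) auto
  then show "(q + 1) * q div 4 > 0" by simp
  have "q * 3 \<le> q * (q - 1)" using q_ge by (intro mult_mono) auto
  moreover have "(q + 1) * q = q * (q - 1) + 2 * q" using q_ge by (cases q) (auto simp: algebra_simps)
  ultimately have "(q + 1) * q + q \<le> 2 * (q * (q - 1))" by linarith
  moreover have "2 * (q * (q - 1) div 2) = q * (q - 1)" using q_even by simp
  ultimately show "(q + 1) * q div 4 < q * (q - 1) div 2" using q_ge by linarith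
qed

text \<open>The five cases are the five distances; the leading 0 of the list is c_0, so that
  \<open>\<delta> a w\<close> itself is the index. Only distance 3 needs more than the axioms. At
  distance 4 every neighbour of \<open>w\<close> counts.\<close>

lemma card_c_Y:
  assumes a: "a \<in> Y" and w: "w \<in> Y \<union> Z"
  shows "card {u \<in> nb w. \<delta> a u + 1 = \<delta> a w} = [0, 1, 2, (q + 1) * q div 4, q + 2] ! \<delta> a w"
proof -
  consider "w = a" | "w \<in> Z" "I a w" | "w \<in> Y" "w \<noteq> a" "meets a w" | "w \<in> Z" "\<not> I a w"
    | "w \<in> Y" "w \<noteq> a" "\<not> meets a w" using w by blast
  then show ?thesis
  proof cases
    case 1
    then show ?thesis by (simp add: \<delta>_def)
  next
    case 2
    then have "\<delta> a w = 1" "{u \<in> nb w. \<delta> a u + 1 = \<delta> a w} = {a}"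
      using a not_both by (auto simp: \<delta>_def nb_Z)
    then show ?thesis by simp
  next
    case 3
    then have d: "\<delta> a w = 2" "{u \<in> nb w. \<delta> a u + 1 = \<delta> a w} = {z \<in> Z. I a z \<and> I w z}"
      using a not_both by (auto simp: \<delta>_def nb_Y)
    have "card {z \<in> Z. I a z \<and> I w z} \<noteq> 0" using 3 finite_Z by (auto simp: meets_def)
    with meet[of a w] a 3 d show ?thesis by auto
  next
    case 4
    then have d: "\<delta> a w = 3" "{u \<in> nb w. \<delta> a u + 1 = \<delta> a w} = {y' \<in> Y. I y' w \<and> meets a y'}"
      using a not_both by (auto simp: \<delta>_def nb_Z)
    with card_meeting_through[of a w] a 4 show ?thesis by (simp add: numeral_3_eq_3)
  next
    case 5
    then have d: "\<delta> a w = 4" "{u \<in> nb w. \<delta> a u + 1 = \<delta> a w} = {z \<in> Z. I w z}"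
      using a not_both by (auto simp: \<delta>_def nb_Y meets_def)
    with card_block[of w] 5 show ?thesis by simp
  qed
qed

lemma card_c_Z:
  assumes a: "a \<in> Z" and w: "w \<in> Y \<union> Z"
  shows "card {u \<in> nb w. \<delta> a u + 1 = \<delta> a w} =
    [0, 1, q div 2, q + 1, q * (q - 1) div 2] ! \<delta> a w"
proof -
  have aY: "a \<notin> Y" using a not_both by blast
  consider "w = a" | "w \<in> Y" "I w a" | "w \<in> Z" "w \<noteq> a" "grp a \<noteq> grp w" | "w \<in> Y" "\<not> I w a"
    | "w \<in> Z" "w \<noteq> a" "grp a = grp w" using w by blast
  then show ?thesis
  proof cases
    case 1
    then show ?thesis by (simp add: \<delta>_def)
  next
    case 2
    then have "\<delta> a w = 1" "{u \<in> nb w. \<delta> a u + 1 = \<delta> a w} = {a}"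
      using a aY not_both by (auto simp: \<delta>_def nb_Y)
    then show ?thesis by simp
  next
    case 3
    then have d: "\<delta> a w = 2" "{u \<in> nb w. \<delta> a u + 1 = \<delta> a w} = {y \<in> Y. I y a \<and> I y w}"
      using a aY not_both by (auto simp: \<delta>_def nb_Z)
    with join[of a w] a 3 show ?thesis by simp
  next
    case 4
    \<comment> \<open>Of the \<open>q + 2\<close> points of \<open>w\<close>, only the one in the
      group of \<open>a\<close> is at distance 4 from \<open>a\<close>; the other
      \<open>q + 1\<close> are at distance 2.\<close>
    obtain z0 where z0: "z0 \<in> Z" "I w z0" "grp z0 = grp a"
      using transversal[of w a] 4 a by blast
    have "\<delta> a w = 3" using 4 a aY not_both by (auto simp: \<delta>_def)
    moreover have "{u \<in> nb w. \<delta> a u + 1 = 3} = {z \<in> Z. I w z} - {z0}"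
    proof -
      have "\<delta> a z + 1 = 3 \<longleftrightarrow> z \<noteq> z0" if "z \<in> Z" "I w z" for z
      proof -
        have "grp a = grp z \<longleftrightarrow> z = z0" using same_group_unique[of w z0 z] that z0 4 by auto
        moreover have "a \<noteq> z" using that 4 by blast
        ultimately show ?thesis using that aY by (simp add: \<delta>_def)
      qed
      then show ?thesis using 4 by (auto simp: nb_Y)
    qed
    ultimately show ?thesis using card_block[of w] z0 4 by (simp add: numeral_3_eq_3)
  next
    case 5
    \<comment> \<open>No block through \<open>w\<close> contains \<open>a\<close>, another point of
      the same group, so all of them are at distance 3.\<close>
    then have "\<delta> a w = 4" "{u \<in> nb w. \<delta> a u + 1 = \<delta> a w} = {y \<in> Y. I y w}"
      using a aY not_both same_group_unique[of _ a w] by (auto simp: \<delta>_def nb_Z)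
    with card_point[of w] 5 show ?thesis by simp
  qed
qed

section \<open>The formula is the graph distance\<close>

lemma \<delta>_le_4: "\<delta> a w \<le> 4"
  by (simp add: \<delta>_def)

lemma \<delta>_eq_0_iff: "\<delta> a w = 0 \<longleftrightarrow> a = w"
  by (simp add: \<delta>_def)

text \<open>Lets the distance from a known part determine the part of the other end, and with it the
  valency there.\<close>

lemma even_\<delta>_iff: "a \<in> Y \<union> Z \<Longrightarrow> w \<in> Y \<union> Z \<Longrightarrow> even (\<delta> a w) \<longleftrightarrow> (a \<in> Y \<longleftrightarrow> w \<in> Y)"
  using not_both by (auto simp: \<delta>_def)

text \<open>A block through a point of \<open>a\<close> meets \<open>a\<close>, and distinct points
  of one group share no block. Besides the growth condition of \<open>gdist_eqI\<close>, this yields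
  b_i as valency minus c_i.\<close>

lemma \<delta>_step:
  assumes a: "a \<in> Y \<union> Z" and arc: "(u, v) \<in> parcs G"
  shows "\<delta> a u + 1 = \<delta> a v \<or> \<delta> a u = \<delta> a v + 1"
proof -
  have *: "\<delta> a y + 1 = \<delta> a z \<or> \<delta> a y = \<delta> a z + 1" if "y \<in> Y" "z \<in> Z" "I y z" for y z
  proof (cases "a \<in> Y")
    case True
    then show ?thesis using that not_both by (auto simp: \<delta>_def meets_def)
  next
    case False
    then show ?thesis using that a not_both same_group_unique[of y a z] by (auto simp: \<delta>_def)
  qed
  show ?thesis using arc *[of u v] *[of v u] by (auto simp: G_def)
qed

text \<open>The counts already obtained show c_i > 0 for each i from 1 to 4.\<close>

lemma \<delta>_pred:
  assumes a: "a \<in> Y \<union> Z" and w: "w \<in> Y \<union> Z" "w \<noteq> a"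
  shows "\<exists>u. (u, w) \<in> parcs G \<and> \<delta> a w = \<delta> a u + 1"
proof -
  have "\<delta> a w \<in> {1, 2, 3, 4}" using \<delta>_le_4[of a w] \<delta>_eq_0_iff[of a w] w by auto
  moreover have "q div 2 > 0" using q_ge by simp
  ultimately have "card {u \<in> nb w. \<delta> a u + 1 = \<delta> a w} > 0"
    using card_c_Y[of a w] card_c_Z[of a w] a w c_pos degree_pos by (auto simp: numeral_3_eq_3)
  then obtain u where "u \<in> nb w" "\<delta> a u + 1 = \<delta> a w"
    by (metis (mono_tags, lifting) Collect_empty_eq card.empty less_irrefl)
  then show ?thesis by (auto simp: nb_def G_def)
qed

lemma pair_graph_G: "pair_graph G"
proof
  show "fst e \<in> pverts G" "snd e \<in> pverts G" if "e \<in> parcs G" for e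
    using that by (auto simp: G_def)
  show "finite (pverts G)" using finite_Y finite_Z by (simp add: G_def)
  have "parcs G \<subseteq> (Y \<union> Z) \<times> (Y \<union> Z)" by (auto simp: G_def)
  then show "finite (parcs G)" using finite_Y finite_Z by (auto intro: finite_subset)
  show "fst e \<noteq> snd e" if "e \<in> parcs G" for e
    using that not_both by (auto simp: G_def)
  show "symmetric G" by (auto simp: symmetric_def sym_def G_def arcs_ends_def arc_to_ends_def)
qed

lemma gdist_G:
  assumes "a \<in> Y \<union> Z" "w \<in> Y \<union> Z"
  shows "gdist G a w = \<delta> a w" and "a \<rightarrow>\<^sup>*\<^bsub>with_proj G\<^esub> w"
proof -
  interpret pair_graph G by (rule pair_graph_G)
  have a: "a \<in> pverts G" "\<delta> a a = 0" and w: "w \<in> pverts G"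
    using assms by (simp_all add: pverts_G \<delta>_eq_0_iff)
  have step: "\<delta> a v \<le> \<delta> a u + 1" if "(u, v) \<in> parcs G" for u v
    using \<delta>_step[OF assms(1) that] by linarith
  have pred: "\<exists>u. (u, v) \<in> parcs G \<and> \<delta> a v = \<delta> a u + 1" if "v \<in> pverts G" "v \<noteq> a" for v
    using \<delta>_pred[OF assms(1)] that by (simp add: pverts_G)
  show "gdist G a w = \<delta> a w"
    by (rule gdist_eqI(1)[of a "\<delta> a", OF a step pred w])
  show "a \<rightarrow>\<^sup>*\<^bsub>with_proj G\<^esub> w"
    by (rule gdist_eqI(2)[of a "\<delta> a", OF a step pred w])
qed

lemma gdist_G_nb:
  assumes "a \<in> Y \<union> Z" "u \<in> nb w"
  shows "gdist G a u = \<delta> a u"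
proof -
  have "u \<in> Y \<union> Z" using assms(2) by (auto simp: nb_def G_def)
  with assms(1) show ?thesis by (rule gdist_G(1))
qed

lemma c_number_G:
  assumes "a \<in> Y \<union> Z" "w \<in> Y \<union> Z"
  shows "c_number G a w = card {u \<in> nb w. \<delta> a u + 1 = \<delta> a w}"
proof -
  have "c_number G a w = card {u \<in> nb w. gdist G a u + 1 = gdist G a w}"
    by (simp add: c_number_def nb_def)
  also have "{u \<in> nb w. gdist G a u + 1 = gdist G a w} = {u \<in> nb w. \<delta> a u + 1 = \<delta> a w}"
    using gdist_G_nb[OF assms(1), of _ w] gdist_G(1)[OF assms] by (intro Collect_cong) auto
  finally show ?thesis .
qed

lemma b_number_G:
  assumes "a \<in> Y \<union> Z" "w \<in> Y \<union> Z"
  shows "b_number G a w = card (nb w) - c_number G a w"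
proof -
  have "b_number G a w = card {u \<in> nb w. gdist G a u = gdist G a w + 1}"
    by (simp add: b_number_def nb_def)
  also have "{u \<in> nb w. gdist G a u = gdist G a w + 1} = {u \<in> nb w. \<delta> a u = \<delta> a w + 1}"
    using gdist_G_nb[OF assms(1), of _ w] gdist_G(1)[OF assms] by (intro Collect_cong) auto
  also have "\<dots> = nb w - {u \<in> nb w. \<delta> a u + 1 = \<delta> a w}"
  proof -
    have "\<delta> a u = \<delta> a w + 1 \<longleftrightarrow> \<delta> a u + 1 \<noteq> \<delta> a w" if "u \<in> nb w" for u
      using \<delta>_step[OF assms(1), of w u] that by (auto simp: nb_def)
    then show ?thesis by blast
  qed
  also have "card \<dots> = card (nb w) - card {u \<in> nb w. \<delta> a u + 1 = \<delta> a w}"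
    using finite_nb[OF assms(2)] by (intro card_Diff_subset) auto
  finally show ?thesis by (simp only: c_number_G[OF assms])
qed

section \<open>Valencies, connectedness, eccentricities and the intersection array\<close>

lemma card_nb:
  assumes "w \<in> Y \<union> Z"
  shows "card (nb w) = (if w \<in> Y then q + 2 else q * (q - 1) div 2)"
  using assms card_block card_point by (auto simp: nb_Y nb_Z)

lemma out_degree_G: "out_degree (with_proj G) a = card (nb a)"
proof -
  have "out_arcs (with_proj G) a = Pair a ` nb a" by (auto simp: nb_def)
  then show ?thesis by (simp add: out_degree_def card_image inj_on_def)
qed

lemma Y_nonempty: "Y \<noteq> {}"
proof -
  obtain z where "z \<in> Z" using Z_nonempty by blast
  with card_point degree_pos have "{y \<in> Y. I y z} \<noteq> {}" by (metis card.empty less_irrefl)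
  then show ?thesis by blast
qed

lemma bipartition_G: "bipartition G Y Z"
  using Y_nonempty Z_nonempty disjoint by (auto simp: bipartition_def G_def)

lemma connected_G: "Digraph_Component.connected (with_proj G)"
proof -
  interpret pair_graph G by (rule pair_graph_G)
  show ?thesis
  proof (rule connectedI)
    show "u \<rightarrow>\<^sup>*\<^bsub>with_proj (mk_symmetric (with_proj G))\<^esub> v"
      if "u \<in> pverts G" "v \<in> pverts G" for u v
      using gdist_G(2) that by (intro reachable_mk_symmetricI) (simp add: pverts_G)
  qed (use Y_nonempty in \<open>simp add: pverts_G\<close>)
qed

text \<open>For a point, another point of its group serves. For a block, choose a point
  \<open>z1\<close> off it: by \<open>c_less_degree\<close> some block through \<open>z1\<close>
  does not meet \<open>a\<close>.\<close>

lemma distance_4_exists: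
  assumes a: "a \<in> Y \<union> Z"
  shows "\<exists>w\<in>Y \<union> Z. \<delta> a w = 4"
proof (cases "a \<in> Z")
  case True
  then show ?thesis using group_nontrivial[of a] not_both by (force simp: \<delta>_def)
next
  case False
  then have aY: "a \<in> Y" using a by simp
  obtain z where z: "z \<in> Z" using Z_nonempty by blast
  obtain z0 where z0: "z0 \<in> Z" "I a z0" "grp z0 = grp z" using transversal[OF aY z] by blast
  obtain z1 where z1: "z1 \<in> Z" "z1 \<noteq> z0" "grp z1 = grp z0" using group_nontrivial z0 by blast
  then have "\<not> I a z1" using same_group_unique[OF aY] z0 by metis
  then have "card {y \<in> Y. I y z1 \<and> meets a y} < card {y \<in> Y. I y z1}"
    using card_meeting_through[of a z1] card_point[of z1] aY z1 c_less_degree by simp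
  then have "{y \<in> Y. I y z1 \<and> meets a y} \<noteq> {y \<in> Y. I y z1}" by (metis less_irrefl)
  then obtain y where "y \<in> Y" "I y z1" "\<not> meets a y" by blast
  then show ?thesis using aY \<open>\<not> I a z1\<close> by (auto simp: \<delta>_def intro!: bexI[of _ y])
qed

lemma eccentricity_G:
  assumes a: "a \<in> Y \<union> Z"
  shows "eccentricity G a = 4"
proof -
  have "gdist G a ` pverts G = \<delta> a ` (Y \<union> Z)"
    using gdist_G(1) a by (auto simp: pverts_G)
  moreover have "Max (\<delta> a ` (Y \<union> Z)) = 4"
  proof (rule Max_eqI)
    show "4 \<in> \<delta> a ` (Y \<union> Z)" using distance_4_exists[OF a] by force
  qed (use finite_Y finite_Z \<delta>_le_4 in auto)
  ultimately show ?thesis by (simp add: eccentricity_def)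
qed

theorem distance_biregular_G: "distance_biregular G Y Z"
proof -
  have "c_number G a w = c_number G a' w' \<and> b_number G a w = b_number G a' w'"
    if P: "P \<in> {Y, Z}" and a: "a \<in> P" "a' \<in> P" and w: "w \<in> pverts G" "w' \<in> pverts G"
      and d: "gdist G a w = gdist G a' w'" for P a a' w w'
  proof -
    have in_G: "a \<in> Y \<union> Z" "a' \<in> Y \<union> Z" "w \<in> Y \<union> Z" "w' \<in> Y \<union> Z"
      using P a w by (auto simp: pverts_G)
    have d': "\<delta> a w = \<delta> a' w'" using d gdist_G(1) in_G by simp
    \<comment> \<open>By parity, equal distances from the same part end in the same part; so the
      valencies agree and the b numbers follow from the c numbers.\<close>
    have "w \<in> Y \<longleftrightarrow> w' \<in> Y"
      using even_\<delta>_iff[of a w] even_\<delta>_iff[of a' w'] in_G d' P a not_both by auto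
    moreover have "c_number G a w = c_number G a' w'"
      using P a card_c_Y[of a w] card_c_Y[of a' w'] card_c_Z[of a w] card_c_Z[of a' w'] in_G d'
      by (auto simp: c_number_G)
    ultimately show ?thesis using b_number_G card_nb in_G by simp
  qed
  then show ?thesis
    unfolding distance_biregular_def using pair_graph_G connected_G bipartition_G by blast
qed

theorem has_intersection_array_G:
  "has_intersection_array G Y Z
     (q + 2, [1, 2, (q + 1) * q div 4, q + 2])
     (q * (q - 1) div 2, [1, q div 2, q + 1, q * (q - 1) div 2])"
proof -
  have "array_row G Y (q + 2) [1, 2, (q + 1) * q div 4, q + 2]"
    unfolding array_row_def using card_c_Y
    by (auto simp: out_degree_G card_nb eccentricity_G pverts_G c_number_G gdist_G nth_Cons')
  moreover have "array_row G Z (q * (q - 1) div 2) [1, q div 2, q + 1, q * (q - 1) div 2]"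
    unfolding array_row_def using card_c_Z not_both
    by (auto simp: out_degree_G card_nb eccentricity_G pverts_G c_number_G gdist_G nth_Cons')
  ultimately show ?thesis by (simp add: has_intersection_array_def)
qed

end

section \<open>The code of a hyperoval\<close>

text \<open>
  \<open>V\<close> stands for the linear functionals on \<open>F\<^sup>3\<close> and \<open>ev\<close> for evaluation; of the vector space
  structure only \<open>|V| = q\<^sup>3\<close> and the number of agreements of two words is needed.
\<close>

locale hyperoval_code =
  fixes q :: nat and F :: "'k::zero set" and P :: "'p set" and V :: "'f set"
    and ev :: "'f \<Rightarrow> 'p \<Rightarrow> 'k"
  assumes q_ge: "q \<ge> 4"
    and card_F: "card F = q" and zero_F: "0 \<in> F"
    and card_P: "card P = q + 2"
    and card_V: "card V = q ^ 3"
    and ev_F: "f \<in> V \<Longrightarrow> p \<in> P \<Longrightarrow> ev f p \<in> F"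
    and zero_V: "\<exists>z\<in>V. \<forall>p\<in>P. ev z p = 0"
    and agree: "f \<in> V \<Longrightarrow> g \<in> V \<Longrightarrow> f \<noteq> g \<Longrightarrow> card {p \<in> P. ev f p = ev g p} \<in> {0, 2}"
begin

section \<open>Interpolation at two and three points\<close>

lemma finite_F: "finite F" and finite_P: "finite P" and finite_V: "finite V"
  using q_ge card_F card_P card_V by (auto intro!: card_ge_0_finite)

text \<open>By \<open>agree\<close>, words that agree at three points coincide; surjectivity follows
  since both sides have \<open>q ^ 3\<close> elements.\<close>

lemma bij_betw_interpolation:
  assumes "p1 \<in> P" "p2 \<in> P" "p3 \<in> P" "p1 \<noteq> p2" "p1 \<noteq> p3" "p2 \<noteq> p3"
  shows "bij_betw (\<lambda>f. (ev f p1, ev f p2, ev f p3)) V (F \<times> F \<times> F)"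
proof -
  let ?e = "\<lambda>f. (ev f p1, ev f p2, ev f p3)"
  have inj: "inj_on ?e V"
  proof (rule inj_onI, rule ccontr)
    fix f g assume fg: "f \<in> V" "g \<in> V" "?e f = ?e g" "f \<noteq> g"
    have "card {p1, p2, p3} \<le> card {p \<in> P. ev f p = ev g p}"
      using fg assms finite_P by (intro card_mono) auto
    then show False using agree[of f g] fg assms by auto
  qed
  have "?e ` V = F \<times> F \<times> F"
  proof (rule card_subset_eq)
    show "finite (F \<times> F \<times> F)" using finite_F by simp
    show "?e ` V \<subseteq> F \<times> F \<times> F" using ev_F assms by auto
    show "card (?e ` V) = card (F \<times> F \<times> F)"
      using card_image[OF inj] by (simp add: card_V card_cartesian_product card_F power3_eq_cube)
  qed
  with inj show ?thesis by (simp add: bij_betw_def)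
qed

lemma card_interpolation_3:
  assumes "p1 \<in> P" "p2 \<in> P" "p3 \<in> P" "p1 \<noteq> p2" "p1 \<noteq> p3" "p2 \<noteq> p3"
    and "a \<in> F" "b \<in> F" "c \<in> F"
  shows "card {f \<in> V. ev f p1 = a \<and> ev f p2 = b \<and> ev f p3 = c} = 1"
proof -
  note bij = bij_betw_interpolation[OF assms(1-6)]
  have "(a, b, c) \<in> (\<lambda>f. (ev f p1, ev f p2, ev f p3)) ` V"
    unfolding bij_betw_imp_surj_on[OF bij] using assms by simp
  then obtain f where f: "f \<in> V" "(a, b, c) = (ev f p1, ev f p2, ev f p3)"
    by (rule imageE)
  have "{f \<in> V. ev f p1 = a \<and> ev f p2 = b \<and> ev f p3 = c} = {f}"
  proof (intro equalityI subsetI)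
    fix g assume "g \<in> {f \<in> V. ev f p1 = a \<and> ev f p2 = b \<and> ev f p3 = c}"
    then show "g \<in> {f}"
      using inj_onD[OF bij_betw_imp_inj_on[OF bij], of g f] f by simp
  qed (use f in auto)
  then show ?thesis by simp
qed

text \<open>Sorting the words by their value at a third point leaves exactly one for each of the
  \<open>q\<close> values.\<close>

lemma card_interpolation_2:
  assumes "p1 \<in> P" "p2 \<in> P" "p1 \<noteq> p2" "a \<in> F" "b \<in> F"
  shows "card {f \<in> V. ev f p1 = a \<and> ev f p2 = b} = q"
proof -
  have "\<not> P \<subseteq> {p1, p2}"
    using card_mono[of "{p1, p2}" P] card_P q_ge card_insert_le_m1[of 2 "{p2}" p1] by auto
  then obtain p3 where p3: "p3 \<in> P" "p3 \<noteq> p1" "p3 \<noteq> p2" by auto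
  let ?S = "{f \<in> V. ev f p1 = a \<and> ev f p2 = b}"
  have "card ?S = (\<Sum>f\<in>?S. card {c \<in> F. ev f p3 = c})"
  proof -
    have "{c \<in> F. ev f p3 = c} = {ev f p3}" if "f \<in> ?S" for f
      using that ev_F p3 by auto
    then show ?thesis by simp
  qed
  also have "\<dots> = (\<Sum>c\<in>F. 1)"
  proof (rule sum_multicount_gen)
    show "\<forall>c\<in>F. card {f \<in> ?S. ev f p3 = c} = 1"
      using card_interpolation_3[of p1 p2 p3 a b] assms p3 by (auto simp: conj_assoc)
  qed (use finite_V finite_F in auto)
  finally show ?thesis using card_F by simp
qed

section \<open>Nowhere vanishing words, the future blocks\<close>

definition N :: "'f set" where
  "N = {f \<in> V. \<forall>p\<in>P. ev f p \<noteq> 0}"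

text \<open>Words with a zero are counted through pairs of a word and one of its zeros. The doubled
  form does not presuppose that \<open>q\<close> is even; \<open>q_even\<close> is deduced from
  it.\<close>

lemma card_join:
  assumes "p1 \<in> P" "p2 \<in> P" "p1 \<noteq> p2" "a \<in> F - {0}" "b \<in> F - {0}"
  shows "2 * card {f \<in> N. ev f p1 = a \<and> ev f p2 = b} = q"
proof -
  let ?S = "{f \<in> V. ev f p1 = a \<and> ev f p2 = b}"
  let ?B = "{f \<in> ?S. \<exists>p\<in>P. ev f p = 0}"
  obtain z where z: "z \<in> V" "\<And>p. p \<in> P \<Longrightarrow> ev z p = 0" using zero_V by blast
  have fin: "finite ?S" using finite_V by simp
  \<comment> \<open>Zeros of \<open>f\<close> are its agreements with the zero word
    \<open>z\<close>, and \<open>f\<close> differs from \<open>z\<close> because \<open>a\<close> is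
    nonzero.\<close>
  have zeros: "card {p \<in> P. ev f p = 0} = (if \<exists>p\<in>P. ev f p = 0 then 2 else 0)" if "f \<in> ?S" for f
  proof -
    have "f \<noteq> z" using that z assms by auto
    moreover have "{p \<in> P. ev f p = ev z p} = {p \<in> P. ev f p = 0}" using z by auto
    ultimately have "card {p \<in> P. ev f p = 0} \<in> {0, 2}" using agree[of f z] that z by auto
    moreover have "card {p \<in> P. ev f p = 0} = 0 \<longleftrightarrow> \<not> (\<exists>p\<in>P. ev f p = 0)"
      using finite_P by auto
    ultimately show ?thesis by auto
  qed
  have "2 * card ?B = (\<Sum>f\<in>?S. card {p \<in> P. ev f p = 0})"
    using fin by (simp add: zeros sum.If_cases Int_def)
  also have "\<dots> = (\<Sum>p\<in>P. if p \<in> {p1, p2} then 0 else 1)"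
  proof (rule sum_multicount_gen)
    have "card {f \<in> ?S. ev f p = 0} = 1" if "p \<in> P" "p \<notin> {p1, p2}" for p
      using card_interpolation_3[of p1 p2 p a b 0] assms that zero_F by (auto simp: conj_assoc)
    moreover have "{f \<in> ?S. ev f p = 0} = {}" if "p \<in> {p1, p2}" for p
      using that assms by auto
    ultimately show "\<forall>p\<in>P. card {f \<in> ?S. ev f p = 0} = (if p \<in> {p1, p2} then 0 else 1)"
      by (simp add: card_eq_0_iff)
  qed (use finite_V finite_P in auto)
  also have "\<dots> = card (P - {p1, p2})"
    using finite_P by (auto simp: sum.If_cases intro!: arg_cong[where f = card])
  also have "\<dots> = q" using assms card_P by (subst card_Diff_subset) auto
  finally have B: "2 * card ?B = q" .
  have "{f \<in> N. ev f p1 = a \<and> ev f p2 = b} = ?S - ?B" by (auto simp: N_def)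
  moreover have "card (?S - ?B) = card ?S - card ?B"
    by (rule card_Diff_subset) (use fin in \<open>auto intro: rev_finite_subset\<close>)
  moreover have "card ?S = q" using card_interpolation_2 assms by simp
  ultimately have "card {f \<in> N. ev f p1 = a \<and> ev f p2 = b} = q - card ?B" by simp
  with B show ?thesis by linarith
qed

lemma q_even: "even q"
proof -
  have "card P > 1" "card (F - {0}) > 0" using card_P card_F zero_F finite_F q_ge by auto
  then obtain p1 p2 a where "p1 \<in> P" "p2 \<in> P" "p1 \<noteq> p2" "a \<in> F - {0}"
    by (metis One_nat_def card_gt_0_iff card_le_Suc0_iff_eq equals0I finite_P not_le)
  \<comment> \<open>The same nonzero value is prescribed at both points.\<close>
  from card_join[OF this this(4)] show ?thesis by (metis dvd_triv_left)
qed

text \<open>Sums \<open>card_join\<close> over the \<open>q - 1\<close> nonzero values at a second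
  point.\<close>

lemma card_through:
  assumes "p \<in> P" "a \<in> F - {0}"
  shows "2 * card {f \<in> N. ev f p = a} = q * (q - 1)"
proof -
  have "\<not> P \<subseteq> {p}"
    using card_mono[of "{p}" P] card_P q_ge by auto
  then obtain p2 where p2: "p2 \<in> P" "p \<noteq> p2" by auto
  let ?S = "{f \<in> N. ev f p = a}"
  have N: "N \<subseteq> V" by (auto simp: N_def)
  have "card ?S = (\<Sum>f\<in>?S. card {c \<in> F - {0}. ev f p2 = c})"
  proof -
    have "{c \<in> F - {0}. ev f p2 = c} = {ev f p2}" if "f \<in> ?S" for f
      using that ev_F p2 by (auto simp: N_def)
    then show ?thesis by simp
  qed
  also have "\<dots> = (\<Sum>c\<in>F-{0}. q div 2)"
  proof (rule sum_multicount_gen)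
    show "\<forall>c\<in>F - {0}. card {f \<in> ?S. ev f p2 = c} = q div 2"
    proof
      fix c assume "c \<in> F - {0}"
      from card_join[OF assms(1) p2 assms(2) this] show "card {f \<in> ?S. ev f p2 = c} = q div 2"
        by (simp add: conj_assoc)
    qed
  qed (use finite_V finite_F N in \<open>auto intro: finite_subset\<close>)
  also have "\<dots> = (q - 1) * (q div 2)" using card_F zero_F finite_F by simp
  finally show ?thesis using q_even by auto
qed

section \<open>The transversal design of the code\<close>

definition Points :: "('p \<times> 'k) set" where
  "Points = P \<times> (F - {0})"

lemma finite_Points: "finite Points"
  using finite_P finite_F by (simp add: Points_def)

lemma finite_N: "finite N"
  using finite_V by (simp add: N_def)

text \<open>Words and points have different types but must become vertices of one graph, so
  \<open>eY\<close> and \<open>eZ\<close> encode them with disjoint images. A block is the graph of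
  a word, and the group of a point is its first coordinate.\<close>

lemma transversal_design:
  fixes eY :: "'f \<Rightarrow> 'v" and eZ :: "'p \<times> 'k \<Rightarrow> 'v"
  assumes injY: "inj_on eY N" and injZ: "inj_on eZ Points"
    and disj: "eY ` N \<inter> eZ ` Points = {}"
  defines "I \<equiv> \<lambda>y z. \<exists>f\<in>N. \<exists>p\<in>P. y = eY f \<and> z = eZ (p, ev f p)"
  shows "transversal_design (eY ` N) (eZ ` Points) I (\<lambda>z. fst (inv_into Points eZ z)) q"
proof -
  let ?grp = "\<lambda>z. fst (inv_into Points eZ z)"
  have ev_Points: "(p, ev f p) \<in> Points" if "f \<in> N" "p \<in> P" for f p
    using that ev_F by (auto simp: N_def Points_def)
  have I_iff: "I (eY f) (eZ (p, c)) \<longleftrightarrow> ev f p = c" if "f \<in> N" "(p, c) \<in> Points" for f p c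
  proof
    assume "I (eY f) (eZ (p, c))"
    then obtain g r where g: "g \<in> N" "r \<in> P" "eY f = eY g" "eZ (p, c) = eZ (r, ev g r)"
      by (auto simp: I_def)
    then have "f = g" "(p, c) = (r, ev g r)"
      using inj_onD[OF injY] inj_onD[OF injZ] that ev_Points by blast+
    then show "ev f p = c" by simp
  next
    assume "ev f p = c"
    then show "I (eY f) (eZ (p, c))" using that by (auto simp: I_def Points_def)
  qed
  have grp: "?grp (eZ (p, c)) = p" if "(p, c) \<in> Points" for p c
    using that injZ by simp
  have block: "{z \<in> eZ ` Points. I (eY f) z} = (\<lambda>p. eZ (p, ev f p)) ` P" if "f \<in> N" for f
    using that I_iff ev_Points by (force simp: Points_def)
  have inj_block: "inj_on (\<lambda>p. eZ (p, ev f p)) P" if "f \<in> N" for f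
    using that ev_Points inj_onD[OF injZ] by (fastforce intro: inj_onI)
  have through: "{y \<in> eY ` N. I y (eZ (p, c))} = eY ` {f \<in> N. ev f p = c}"
    if "(p, c) \<in> Points" for p c
    using that I_iff by auto
  have card_eY: "card (eY ` {f \<in> N. Q f}) = card {f \<in> N. Q f}" for Q
    by (intro card_image inj_on_subset[OF injY]) auto
  have F_ge: "card (F - {0}) \<ge> 3" using card_F zero_F finite_F q_ge by simp
  show ?thesis
  proof
    show "finite (eY ` N)" "finite (eZ ` Points)" using finite_N finite_Points by simp_all
    show "eY ` N \<inter> eZ ` Points = {}" by (rule disj)
    have "P \<noteq> {}" using card_P by auto
    moreover have "F - {0} \<noteq> {}" using F_ge by (metis card.empty not_numeral_le_zero)
    ultimately show "eZ ` Points \<noteq> {}" by (simp add: Points_def)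
    show "q \<ge> 4" "even q" by (rule q_ge, rule q_even)
    show "\<exists>!z'. z' \<in> eZ ` Points \<and> I y z' \<and> ?grp z' = ?grp z"
      if "y \<in> eY ` N" "z \<in> eZ ` Points" for y z
    proof -
      from that obtain f p c where f: "f \<in> N" "y = eY f" and p: "(p, c) \<in> Points" "z = eZ (p, c)" by auto
      have pP: "p \<in> P" using p by (simp add: Points_def)
      show ?thesis
      proof (rule ex1I[of _ "eZ (p, ev f p)"])
        show "eZ (p, ev f p) \<in> eZ ` Points \<and> I y (eZ (p, ev f p)) \<and> ?grp (eZ (p, ev f p)) = ?grp z"
          using f p pP ev_Points I_iff grp by simp
        show "z' = eZ (p, ev f p)" if "z' \<in> eZ ` Points \<and> I y z' \<and> ?grp z' = ?grp z" for z'
          using that f p I_iff grp by auto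
      qed
    qed
    show "card {z \<in> eZ ` Points. I y z} = q + 2" if "y \<in> eY ` N" for y
      using that block inj_block card_P by (auto simp: card_image)
    show "card {y \<in> eY ` N. I y z} = q * (q - 1) div 2" if "z \<in> eZ ` Points" for z
    proof -
      from that obtain p c where p: "(p, c) \<in> Points" "z = eZ (p, c)" by auto
      then have "2 * card {f \<in> N. ev f p = c} = q * (q - 1)"
        by (intro card_through) (auto simp: Points_def)
      then show ?thesis using through[OF p(1)] p card_eY by simp
    qed
    show "card {z \<in> eZ ` Points. I y z \<and> I y' z} \<in> {0, 2}"
      if "y \<in> eY ` N" "y' \<in> eY ` N" "y \<noteq> y'" for y y'
    proof -
      from that obtain f g where f: "f \<in> N" "y = eY f" and g: "g \<in> N" "y' = eY g" and "f \<noteq> g" by auto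
      \<comment> \<open>Common points of two graphs correspond to the positions where the words
        agree.\<close>
      have "{z \<in> eZ ` Points. I y z \<and> I y' z} = {z \<in> (\<lambda>p. eZ (p, ev f p)) ` P. I y' z}"
        using block[OF f(1)] f(2) by blast
      also have "\<dots> = (\<lambda>p. eZ (p, ev f p)) ` {p \<in> P. ev f p = ev g p}"
        using I_iff[OF g(1)] ev_Points[OF f(1)] g(2) by fastforce
      also have "card \<dots> = card {p \<in> P. ev f p = ev g p}"
        by (intro card_image inj_on_subset[OF inj_block[OF f(1)]]) auto
      finally show ?thesis using agree[of f g] f g \<open>f \<noteq> g\<close> by (simp add: N_def)
    qed
    show "card {y \<in> eY ` N. I y z \<and> I y z'} = q div 2"
      if "z \<in> eZ ` Points" "z' \<in> eZ ` Points" "?grp z \<noteq> ?grp z'" for z z'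
    proof -
      from that obtain p c p' c' where p: "(p, c) \<in> Points" "z = eZ (p, c)"
        and p': "(p', c') \<in> Points" "z' = eZ (p', c')" by auto
      then have "p \<noteq> p'" using that grp by auto
      have "{y \<in> eY ` N. I y z \<and> I y z'} = eY ` {f \<in> N. ev f p = c \<and> ev f p' = c'}"
        using I_iff p p' by auto
      moreover have "2 * card {f \<in> N. ev f p = c \<and> ev f p' = c'} = q"
        using p p' \<open>p \<noteq> p'\<close> by (intro card_join) (auto simp: Points_def)
      ultimately show ?thesis using card_eY by simp
    qed
    show "\<exists>z'\<in>eZ ` Points. z' \<noteq> z \<and> ?grp z' = ?grp z" if "z \<in> eZ ` Points" for z
    proof -
      from that obtain p c where p: "(p, c) \<in> Points" "z = eZ (p, c)" by auto
      have "\<not> F - {0} \<subseteq> {c}" using F_ge card_mono[of "{c}" "F - {0}"] by auto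
      then obtain c' where c': "(p, c') \<in> Points" "c' \<noteq> c" using p by (auto simp: Points_def)
      then have "eZ (p, c') \<noteq> z" using inj_onD[OF injZ, of "(p, c')" "(p, c)"] p by auto
      with c' p grp show ?thesis by (intro bexI[of _ "eZ (p, c')"]) simp_all
    qed
  qed
qed

end

section \<open>The field with \<open>2\<^sup>m\<close> elements and its regular hyperoval\<close>

text \<open>The polynomial splits into linear factors, and a factor occurring twice would make the
  derivative vanish at its root.\<close>

lemma card_roots_separable:
  fixes p :: "'a::alg_closed_field poly"
  assumes "p \<noteq> 0" and sep: "\<And>x. poly p x = 0 \<Longrightarrow> poly (pderiv p) x \<noteq> 0"
  shows "card {x. poly p x = 0} = degree p"
proof -
  obtain A where A: "size A = degree p" "p = smult (lead_coeff p) (\<Prod>x\<in>#A. [:- x, 1:])"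
    using alg_closed_imp_factorization[OF assms(1)] by blast
  have lc: "lead_coeff p \<noteq> 0" using assms(1) by simp
  have roots: "{x. poly p x = 0} = set_mset A"
    using lc by (subst A(2)) (auto simp: poly_prod_mset)
  have "count A x = 1" if "x \<in># A" for x
  proof (rule ccontr)
    assume "count A x \<noteq> 1"
    with that have "x \<in># A - {#x#}"
      by (metis One_nat_def count_eq_zero_iff diff_single_trivial in_diff_count
          count_single less_one linorder_neqE_nat)
    then obtain B where "A - {#x#} = add_mset x B" by (auto dest: multi_member_split)
    then have "A = add_mset x (add_mset x B)" using insert_DiffM[OF that] by simp
    with A(2) have "p = [:- x, 1:] * ([:- x, 1:] * smult (lead_coeff p) (\<Prod>x\<in>#B. [:- x, 1:]))"
      by (simp add: mult_ac)
    then obtain r where r: "p = [:- x, 1:] * ([:- x, 1:] * r)" by blast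
    have "poly p x = 0" "poly (pderiv p) x = 0"
      unfolding r by (simp_all only: pderiv_mult poly_add poly_mult) simp_all
    with sep show False by blast
  qed
  then have "size A = card (set_mset A)"
    by (simp add: size_multiset_overloaded_eq)
  with roots A(1) show ?thesis by simp
qed

text \<open>X^n - X has derivative -1 because n vanishes in the field, so its n roots are distinct.
  For n = 2^m in characteristic 2 they form the field with 2^m elements.\<close>

lemma card_power_fixed_points:
  assumes "n > 1" "of_nat n = (0 :: 'a::alg_closed_field)"
  shows "card {x::'a. x ^ n = x} = n"
proof -
  define p :: "'a poly" where "p = monom 1 n - monom 1 1"
  have deg: "degree p = n"
    unfolding p_def using assms(1)
    by (metis degree_add_eq_left degree_minus degree_monom_eq diff_conv_add_uminus one_neq_zero)
  have "pderiv p = - 1"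
    using assms by (simp add: p_def pderiv_diff pderiv_monom monom_0 one_pCons)
  then have "card {x. poly p x = 0} = n"
    using card_roots_separable[of p] deg assms(1) by force
  then show ?thesis by (simp add: p_def poly_monom)
qed

lemma two_eq_0_alg_closure_bit: "(2 :: bit alg_closure) = 0"
  by (metis to_ac_numeral bit_numeral_even to_ac_0)

text \<open>\<open>P\<close> is the conic x z = y^2 together with its nucleus (0, 1, 0). A line
  contains the nucleus iff b = 0 and the conic point (0, 0, 1) iff c = 0; its other points in
  \<open>P\<close> are given by the roots of a + b t + c t^2 in \<open>F\<close>.\<close>

lemma hyperoval_zeros:
  fixes F :: "'a::field set"
  defines "P \<equiv> {(0, 1, 0), (0, 0, 1)} \<union> (\<lambda>t. (1, t, t\<^sup>2)) ` F"
  assumes char2: "(2::'a) = 0"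
    and F: "\<And>x y. x \<in> F \<Longrightarrow> y \<in> F \<Longrightarrow> x + y \<in> F"
      "\<And>x y. x \<in> F \<Longrightarrow> y \<in> F \<Longrightarrow> x / y \<in> F"
    and sqrt: "\<And>x. x \<in> F \<Longrightarrow> \<exists>y\<in>F. y\<^sup>2 = x"
    and abc: "a \<in> F" "b \<in> F" "c \<in> F" "(a, b, c) \<noteq> (0, 0, 0)"
  shows "card {(x, y, z) \<in> P. a * x + b * y + c * z = 0} \<in> {0, 2}"
proof -
  have neg: "- x = x" for x :: 'a
    using char2 by (metis add_eq_0_iff mult_2 mult_zero_left)
  have eq_iff: "x + y = 0 \<longleftrightarrow> x = y" for x y :: 'a
    by (metis add_eq_0_iff neg)
  have square_inj: "x\<^sup>2 = y\<^sup>2 \<longleftrightarrow> x = y" for x y :: 'a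
    by (metis neg power2_eq_iff)
  let ?S = "{(x, y, z) \<in> P. a * x + b * y + c * z = 0}"
  let ?R = "{t \<in> F. a + b * t + c * t\<^sup>2 = 0}"
  have S: "?S = {v. v = (0, 1, 0) \<and> b = 0} \<union> {v. v = (0, 0, 1) \<and> c = 0} \<union> (\<lambda>t. (1, t, t\<^sup>2)) ` ?R"
    by (auto simp: P_def)
  consider "b = 0" "c = 0" | "b \<noteq> 0" "c = 0" | "b = 0" "c \<noteq> 0" | "b \<noteq> 0" "c \<noteq> 0" by blast
  then show ?thesis
  proof cases
    case 1
    \<comment> \<open>Here a is nonzero, and the line is x = 0.\<close>
    then have "?R = {}" using abc by auto
    then have "?S = {(0, 1, 0), (0, 0, 1)}" unfolding S using 1 by auto
    then show ?thesis by simp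
  next
    case 2
    have "a + b * t = 0 \<longleftrightarrow> t = a / b" for t
      using 2 by (auto simp: eq_iff field_simps)
    then have "?R = {a / b}" using 2 F(2) abc by auto
    then have "?S = {(0, 0, 1), (1, a / b, (a / b)\<^sup>2)}" unfolding S using 2 by auto
    then show ?thesis by simp
  next
    case 3
    \<comment> \<open>A tangent, through the nucleus: squaring is onto \<open>F\<close> and, in
      characteristic 2, injective, so there is exactly one root.\<close>
    obtain s where s: "s \<in> F" "s\<^sup>2 = a / c" using sqrt F(2) abc by blast
    have "a + c * t\<^sup>2 = 0 \<longleftrightarrow> t = s" for t
    proof -
      have "a + c * t\<^sup>2 = 0 \<longleftrightarrow> t\<^sup>2 = s\<^sup>2"
        unfolding s(2) using 3 by (auto simp: eq_iff field_simps)
      then show ?thesis by (simp add: square_inj)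
    qed
    then have "?R = {s}" using 3 s(1) by auto
    then have "?S = {(0, 1, 0), (1, s, s\<^sup>2)}" unfolding S using 3 by auto
    then show ?thesis by simp
  next
    case 4
    show ?thesis
    proof (cases "\<exists>t\<in>F. a + b * t + c * t\<^sup>2 = 0")
      case True
      then obtain t where t: "t \<in> F" "a + b * t + c * t\<^sup>2 = 0" by blast
      \<comment> \<open>In characteristic 2 the two roots sum to b / c; as this is nonzero they are
        distinct.\<close>
      have "a + b * u + c * u\<^sup>2 = 0 \<longleftrightarrow> u = t \<or> u = t + b / c" for u
      proof -
        have "a + b * u + c * u\<^sup>2 = (a + b * u + c * u\<^sup>2) - (a + b * t + c * t\<^sup>2)"
          using t by simp
        also have "\<dots> = (u - t) * (b + c * (u + t))" by (simp add: algebra_simps power2_eq_square)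
        finally have "a + b * u + c * u\<^sup>2 = 0 \<longleftrightarrow> u = t \<or> b + c * (u + t) = 0" by simp
        also have "b + c * (u + t) = 0 \<longleftrightarrow> b / c = u + t"
          using 4 by (auto simp: eq_iff field_simps)
        also have "\<dots> \<longleftrightarrow> u = t + b / c"
          by (metis add.commute add_diff_cancel_right' diff_conv_add_uminus neg)
        finally show ?thesis .
      qed
      then have "?R = {t, t + b / c}" using t F abc by auto
      then have "?S = {(1, t, t\<^sup>2), (1, t + b / c, (t + b / c)\<^sup>2)}" unfolding S using 4 by simp
      then show ?thesis using 4 by simp
    next
      case False
      then have "?S = {}" unfolding S using 4 by blast
      then have "card ?S = 0" by (simp only: card.empty)
      then show ?thesis by blast
    qed
  qed
qed

section \<open>The code over the field with \<open>q\<close> elements\<close>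

lemma power_two_power_add_char_2:
  fixes x y :: "'a::comm_ring_1"
  assumes "(2::'a) = 0"
  shows "(x + y) ^ 2 ^ m = x ^ 2 ^ m + y ^ 2 ^ m"
proof (induction m)
  case (Suc m)
  have "(x + y) ^ 2 ^ Suc m = ((x + y) ^ 2 ^ m)\<^sup>2"
    by (simp flip: power_mult add: mult.commute)
  also have "\<dots> = (x ^ 2 ^ m)\<^sup>2 + (y ^ 2 ^ m)\<^sup>2"
    using assms by (simp add: Suc.IH power2_sum)
  finally show ?case by (simp flip: power_mult add: mult.commute)
qed simp

text \<open>The field is realised as the fixed points of x -> x^q in the algebraic closure of the
  field with two elements; functionals are coefficient triples.\<close>

lemma hyperoval_code_exists:
  fixes m q :: nat
  assumes "m \<ge> 2" and q: "q = 2 ^ m"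
  shows "\<exists>(F :: bit alg_closure set) P V.
    hyperoval_code q F P V (\<lambda>(a, b, c) (x, y, z). a * x + b * y + c * z)"
proof -
  note char2 = two_eq_0_alg_closure_bit
  define F :: "bit alg_closure set" where "F = {x. x ^ q = x}"
  define P :: "(bit alg_closure \<times> bit alg_closure \<times> bit alg_closure) set"
    where "P = {(0, 1, 0), (0, 0, 1)} \<union> (\<lambda>t. (1, t, t\<^sup>2)) ` F"
  let ?ev = "\<lambda>(a, b, c) (x, y, z). a * x + b * y + c * z :: bit alg_closure"
  have "2 ^ 2 \<le> q" unfolding q using assms(1) by (intro power_increasing) auto
  then have q_ge: "q \<ge> 4" by simp
  have "of_nat q = (0 :: bit alg_closure)" using assms(1) by (simp add: q char2)
  then have card_F: "card F = q" unfolding F_def using q_ge by (intro card_power_fixed_points) auto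
  then have finite_F: "finite F" using q_ge by (intro card_ge_0_finite) auto
  have F01: "0 \<in> F" "1 \<in> F" using q_ge by (simp_all add: F_def)
  have F_add: "x + y \<in> F" if "x \<in> F" "y \<in> F" for x y
    using that by (simp add: F_def q power_two_power_add_char_2[OF char2])
  have F_mult: "x * y \<in> F" and F_div: "x / y \<in> F" if "x \<in> F" "y \<in> F" for x y
    using that by (simp_all add: F_def power_mult_distrib power_divide)
  have neg: "- x = x" for x :: "bit alg_closure"
    using char2 by (metis add_eq_0_iff mult_2 mult_zero_left)
  have F_diff: "x - y \<in> F" if "x \<in> F" "y \<in> F" for x y
    using F_add[OF that] neg[of y] by (metis diff_conv_add_uminus)
  have sqrt: "\<exists>y\<in>F. y\<^sup>2 = x" if "x \<in> F" for x
  \<comment> \<open>The witness squares to x^q, which is x on \<open>F\<close>.\<close>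
  proof (rule bexI[of _ "x ^ (q div 2)"])
    have "q div 2 * 2 = q" using assms(1) by (cases m) (auto simp: q)
    then show "(x ^ (q div 2))\<^sup>2 = x" using that by (simp add: F_def flip: power_mult)
    have "(x ^ (q div 2)) ^ q = (x ^ q) ^ (q div 2)" by (simp flip: power_mult add: mult.commute)
    then show "x ^ (q div 2) \<in> F" using that by (simp add: F_def)
  qed
  have P_subset: "P \<subseteq> F \<times> F \<times> F"
    using F01 F_mult by (auto simp: P_def power2_eq_square)
  have "hyperoval_code q F P (F \<times> F \<times> F) ?ev"
  proof
    show "q \<ge> 4" "card F = q" "0 \<in> F" by (fact q_ge card_F F01)+
    have "card ((\<lambda>t. (1::bit alg_closure, t, t\<^sup>2)) ` F) = q"
      using card_F by (subst card_image) (auto simp: inj_on_def)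
    then show "card P = q + 2"
      unfolding P_def using finite_F by (subst card_Un_disjoint) auto
    show "card (F \<times> F \<times> F) = q ^ 3"
      by (simp add: card_cartesian_product card_F power3_eq_cube)
    show "?ev f p \<in> F" if "f \<in> F \<times> F \<times> F" "p \<in> P" for f p
      using that P_subset F_add F_mult by auto
    show "\<exists>z\<in>F \<times> F \<times> F. \<forall>p\<in>P. ?ev z p = 0"
      using F01 by (intro bexI[of _ "(0, 0, 0)"]) auto
    show "card {p \<in> P. ?ev f p = ?ev g p} \<in> {0, 2}"
      if fg: "f \<in> F \<times> F \<times> F" "g \<in> F \<times> F \<times> F" "f \<noteq> g" for f g
    proof -
      obtain a b c a' b' c' where f: "f = (a, b, c)" and g: "g = (a', b', c')"
        by (metis prod_cases3)
      \<comment> \<open>Agreements of \<open>f\<close> and \<open>g\<close> are the zeros of their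
        difference, a nonzero functional with coefficients in \<open>F\<close>.\<close>
      have "{p \<in> P. ?ev f p = ?ev g p}
          = {(x, y, z) \<in> P. (a - a') * x + (b - b') * y + (c - c') * z = 0}"
        by (auto simp: f g algebra_simps)
      also have "card \<dots> \<in> {0, 2}"
        unfolding P_def using fg
        by (intro hyperoval_zeros char2 F_add F_div sqrt)
          (auto simp: f g intro: F_diff)
      finally show ?thesis .
    qed
  qed
  then show ?thesis by blast
qed

theorem theorem6p2:
  fixes m q :: nat
  assumes "m \<ge> 2" and "q = 2 ^ m"
  shows "\<exists>(G :: nat pair_pre_digraph) Y Z.
           distance_biregular G Y Z \<and>
           has_intersection_array G Y Z
             (q + 2, [1, 2, (q + 1) * q div 4, q + 2])
             (q * (q - 1) div 2, [1, q div 2, q + 1, q * (q - 1) div 2])"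
proof -
  let ?ev = "\<lambda>(a, b, c) (x, y, z). a * x + b * y + c * z :: bit alg_closure"
  obtain F :: "bit alg_closure set" and P V where "hyperoval_code q F P V ?ev"
    using hyperoval_code_exists[OF assms] by blast
  then interpret hyperoval_code q F P V ?ev .
  obtain eY :: "_ \<Rightarrow> nat" where eY: "inj_on eY N"
    using finite_imp_inj_to_nat_seg[OF finite_N] by blast
  obtain eZ :: "_ \<Rightarrow> nat" where eZ: "inj_on eZ Points"
    using finite_imp_inj_to_nat_seg[OF finite_Points] by blast
  \<comment> \<open>Even numbers encode the blocks and odd numbers the points, which keeps the two
    parts disjoint.\<close>
  have inj: "inj_on (\<lambda>f. 2 * eY f) N" "inj_on (\<lambda>z. 2 * eZ z + 1) Points"
    using eY eZ by (simp_all add: inj_on_def)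
  have "(\<lambda>f. 2 * eY f) ` N \<inter> (\<lambda>z. 2 * eZ z + 1) ` Points = {}"
    by (auto dest: arg_cong[where f = even])
  note design = transversal_design[OF inj this]
  show ?thesis
    by (intro exI conjI)
      (rule transversal_design.distance_biregular_G[OF design],
       rule transversal_design.has_intersection_array_G[OF design])
qed

end
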